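(* Let $t=0$, $0<q<1$, $N\ge1$, $a_1,\dots,a_N>0$. Let $\{(W_k,V_k)\}_{k=1}^N$ be a nearest neighbor ($q$-Whittaker-)multivariate `dynamics' on interlacing arrays of depth $N$ satisfying: (R1) for each $k$, the jump rate $W_k(\lambda,\lambda+\mathrm e_1\,|\,\bar\nu)$ of the rightmost particle $\lambda_1=\lambda^{(k)}_1$ does not depend on the coordinates of the remaining (not rightmost) particles $\lambda^{(m)}_j$, $1\le m\le N$, $2\le j\le m$; (R2) for each $k=2,\dots,N$, the probability $V_k(\lambda,\lambda+\mathrm e_1\,|\,\bar\nu-\bar{\mathrm e}_1,\bar\nu)$ that $\lambda^{(k-1)}_1$ long-range pushes $\lambda^{(k)}_1$ also does not depend on the coordinates of these remaining particles; (R3) in the `dynamics' of the whole interlacing array there are no donations of jumps or pushes (the donation rule is recalled in the context). That is, for each $k=2,\dots,N$ and $j=2,\dots,k$, the quantities $W_k(\lambda,\lambda+\mathrm e_j\,|\,\bar\nu)$ and (for $j\le k-1$) $V_k(\lambda,\lambda+\mathrm e_j\,|\,\bar\nu-\bar{\mathrm e}_j,\bar\nu)$ depend on $\bar\nu$ and $\lambda$ in such a way that they automatically become zero if $\lambda_j=\bar\nu_{j-1}$ (i.e., if the particle $\lambda_j=\lambda^{(k)}_j$ is blocked). Then each rightmost particle $\lambda^{(k)}_1$, $k=1,\dots,N$, has jump rate $a_k$, and when any rightmost particle $\lambda^{(k-1)}_1$ moves (due to an independent jump or a push), it long-range pushes the next rightmost particle $\lambda^{(k)}_1$ with probability $q^{\lambda^{(k)}_1-\lambda^{(k-1)}_1}$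 (where $\lambda^{(k-1)}_1$ is the coordinate before the move). This interaction has the possibility to propagate to all the higher levels $k+1,k+2,\dots,N$.
   Context: **Signatures.** $\mathbb{GT}_k=\{\lambda\in\mathbb Z^k:\lambda_1\ge\dots\ge\lambda_k\}$, $\mathbb{GT}_0=\{\varnothing\}$, $|\lambda|=\sum\lambda_i$. $\bar\lambda\prec\lambda$ ($\bar\lambda\in\mathbb{GT}_{k-1},\lambda\in\mathbb{GT}_k$) means $\lambda_{i+1}\le\bar\lambda_i\le\lambda_i$, $1\le i\le k-1$. $\mathrm e_j$, $\bar{\mathrm e}_i$ are standard basis vectors of $\mathbb Z^k$, $\mathbb Z^{k-1}$. Interlacing arrays: $\lambda^{(1)}\prec\dots\prec\lambda^{(N)}$, $\lambda^{(k)}\in\mathbb{GT}_k$; the numbers $\lambda^{(k)}_j$ are particles, and a move increases a coordinate by one (the particle moves to the right by one). In (R1)–(R3), $\lambda=\lambda^{(k)}$ is the old state at level $k$ and $\bar\nu$ the new state at level $k-1$, with $\bar\nu\prec\lambda$ (the case $\bar\nu\not\prec\lambda$ is governed by forced short-range pushing, see below). **Macdonald quantities** (here with $t=0$). $(a;q)_\infty=\prod_{i\ge0}(1-aq^i)$, $f(u)=(tu;q)_\infty/(qu;q)_\infty$, $0^0=1$. For $\kappa\prec\nu$, $\nu\in\mathbb{GT}_m$: $\psi_{\nu/\kappa}=\prod_{1\le i\le j\le m-1}\frac{f(q^{\kappa_i-\kappa_j}t^{j-i})f(q^{\nu_i-\nu_{j+1}}t^{j-i})}{f(q^{\nu_i-\kappa_j}t^{j-i})f(q^{\kappa_i-\nu_{j+1}}t^{j-i})}$,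 and $\psi_{\nu/\kappa}=0$ if $\kappa\not\prec\nu$. For signatures $\mu,\mu+\mathrm e_j$: $\psi'_{\mu+\mathrm e_j/\mu}=\prod_{i=1}^{j-1}\frac{(1-q^{\mu_i-\mu_j}t^{j-i-1})(1-q^{\mu_i-\mu_j-1}t^{j-i+1})}{(1-q^{\mu_i-\mu_j}t^{j-i})(1-q^{\mu_i-\mu_j-1}t^{j-i})}$ (zero if one of them is not a signature). $P_\lambda(a_1,\dots,a_k)=\sum_{\lambda^{(1)}\prec\dots\prec\lambda^{(k)}=\lambda}\prod_{i=1}^k\psi_{\lambda^{(i)}/\lambda^{(i-1)}}a_i^{|\lambda^{(i)}|-|\lambda^{(i-1)}|}$. $\Lambda^k_{k-1}(\lambda,\bar\lambda)=\frac{P_{\bar\lambda}(a_1,\dots,a_{k-1})}{P_\lambda(a_1,\dots,a_k)}\psi_{\lambda/\bar\lambda}a_k^{|\lambda|-|\bar\lambda|}$, $\Lambda^1_0\equiv1$. $Q_k(\lambda,\lambda+\mathrm e_j)=\frac{P_{\lambda+\mathrm e_j}(a_1,\dots,a_k)}{P_\lambda(a_1,\dots,a_k)}\psi'_{\lambda+\mathrm e_j/\lambda}$, other off-diagonal entries $0$, $Q_k(\lambda,\lambda)=-\sum_{\nu\ne\lambda}Q_k(\lambda,\nu)$; $Q_0=0$. **`Dynamics'** (positivity not required). Real functions $W_k(\lambda,\nu|\bar\lambda)$ (rates of independent jumps at level $k$ from $\lambda$ to $\nu$ given level $k-1$ at $\bar\lambda$) and $V_k(\lambda,\nu|\bar\lambda,\bar\nu)$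 (probabilities that a move $\bar\lambda\to\bar\nu$ at level $k-1$ triggers $\lambda\to\nu$ at level $k$), where $\bar\lambda\prec\lambda$, $\bar\nu=\bar\lambda$ or $\bar\lambda+\bar{\mathrm e}_i$, such that: both vanish unless $\nu=\lambda$ or $\nu=\lambda+\mathrm e_j$; moves which would lead to a non-interlacing pair $(\bar\nu,\nu)$ do not occur; $\sum_\nu V_k(\lambda,\nu|\bar\lambda,\bar\nu)=1$; $V_k(\lambda,\nu|\bar\lambda,\bar\lambda)=1_{\lambda=\nu}$; $\sum_{\nu\ne\lambda}W_k(\lambda,\nu|\bar\lambda)=-W_k(\lambda,\lambda|\bar\lambda)$; and for all $\lambda,\nu,\bar\nu$ with $\bar\nu\prec\nu$ $$\sum_{\bar\lambda}V_k(\lambda,\nu|\bar\lambda,\bar\nu)\Lambda^k_{k-1}(\lambda,\bar\lambda)Q_{k-1}(\bar\lambda,\bar\nu)+W_k(\lambda,\nu|\bar\nu)\Lambda^k_{k-1}(\lambda,\bar\nu)=Q_k(\lambda,\nu)\Lambda^k_{k-1}(\nu,\bar\nu).$$ (If $\bar\nu\not\prec\lambda$, $\bar\nu-\bar{\mathrm e}_j\prec\lambda$, $\bar\nu\prec\lambda+\mathrm e_j$, this forces $V_k(\lambda,\lambda+\mathrm e_j|\bar\nu-\bar{\mathrm e}_j,\bar\nu)=1$: short-range pushing.) **Nearest neighbor:** for $\bar\nu\prec\lambda$ let $\mathscr F=\{j\in\{1,\dots,k\}:\lambda_j<\bar\nu_{j-1}\}$ ($\bar\nu_0=+\infty$) be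 the set of indices of free (not blocked) particles, $\xi(i)=\max\{j\le i:j\in\mathscr F\}$. For all $k\ge2$, $\bar\nu\prec\lambda$ and $j$ with $j+1\in\mathscr F$, $V_k(\lambda,\lambda+\mathrm e_m|\bar\nu-\bar{\mathrm e}_j,\bar\nu)=0$ unless $m=j+1$ (the moved particle $\bar\nu_j$ pulls its upper left neighbor) or $m=\xi(j)$ (it long-range pushes its first free upper right neighbor). **Donation rule.** A nearest neighbor `dynamics' can be described by assigning independent jumps and pushes to all particles $\lambda^{(k)}_j$, including blocked ones, with the following rule: if a particle $\lambda^{(k)}_j$ must move to the right by one (due to an independent jump or a triggered move) but is blocked, i.e. $\lambda^{(k)}_j=\lambda^{(k-1)}_{j-1}$, then it donates the move to the first free particle $\lambda^{(k)}_{\xi(j)}$ to the right of itself, which moves instead. "No donations" in (R3) means that this never happens: the jump rate or push probability assigned to a blocked particle is zero, so nothing is passed on to a particle to its right. *)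

theory Defs
  imports "HOL-Analysis.Analysis"
begin

text \<open>A signature of length \<open>k\<close> is stored as a function on the 1-based positions, extended by
  \<open>0\<close> outside \<open>{1..k}\<close>, so that equality of functions is equality of signatures and the
  zero function is the only element of \<open>GT 0\<close>. Variables with a prime live one level below,
  i.e. they are the barred signatures of length \<open>k - 1\<close>.\<close>

type_synonym sig = "nat \<Rightarrow> int"

definition GT :: "nat \<Rightarrow> sig set" where
  "GT k = {lam. (\<forall>i. i \<notin> {1..k} \<longrightarrow> lam i = 0) \<and> (\<forall>i\<in>{1..<k}. lam (i + 1) \<le> lam i)}"

definition wt :: "nat \<Rightarrow> sig \<Rightarrow> int" where
  "wt k lam = (\<Sum>i=1..k. lam i)"

definition inc :: "nat \<Rightarrow> sig \<Rightarrow> sig" where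
  "inc j lam = lam(j := lam j + 1)"

definition dec :: "nat \<Rightarrow> sig \<Rightarrow> sig" where
  "dec j lam = lam(j := lam j - 1)"

definition interl :: "nat \<Rightarrow> sig \<Rightarrow> sig \<Rightarrow> bool" where
  "interl k lam' lam \<longleftrightarrow> k \<ge> 1 \<and> lam' \<in> GT (k - 1) \<and> lam \<in> GT k \<and>
     (\<forall>i\<in>{1..k - 1}. lam (i + 1) \<le> lam' i \<and> lam' i \<le> lam i)"

text \<open>An array \<open>X\<close> of depth \<open>k\<close> has the levels \<open>X 1, \<dots>, X k\<close>; \<open>X 0\<close> is the empty signature.\<close>

definition arrays :: "nat \<Rightarrow> (nat \<Rightarrow> sig) set" where
  "arrays k = {X. (\<forall>m\<in>{1..k}. interl m (X (m - 1)) (X m)) \<and> (\<forall>m. m \<notin> {1..k} \<longrightarrow> X m = (\<lambda>_. 0))}"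

definition qpoch_inf :: "real \<Rightarrow> real \<Rightarrow> real" where
  "qpoch_inf q b = (\<Prod>i. 1 - b * q ^ i)"

definition mac_f :: "real \<Rightarrow> real \<Rightarrow> real \<Rightarrow> real" where
  "mac_f q t u = qpoch_inf q (t * u) / qpoch_inf q (q * u)"

definition psi :: "real \<Rightarrow> real \<Rightarrow> nat \<Rightarrow> sig \<Rightarrow> sig \<Rightarrow> real" where
  "psi q t m nu kap =
     (if interl m kap nu then
        \<Prod>j=1..m - 1. \<Prod>i=1..j.
          (mac_f q t (q powi (kap i - kap j) * t ^ (j - i)) *
           mac_f q t (q powi (nu i - nu (j + 1)) * t ^ (j - i))) /
          (mac_f q t (q powi (nu i - kap j) * t ^ (j - i)) *
           mac_f q t (q powi (kap i - nu (j + 1)) * t ^ (j - i)))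
      else 0)"

text \<open>\<open>psi_up q t k mu j\<close> is $\psi'_{\mu+\mathrm e_j/\mu}$.\<close>

definition psi_up :: "real \<Rightarrow> real \<Rightarrow> nat \<Rightarrow> sig \<Rightarrow> nat \<Rightarrow> real" where
  "psi_up q t k mu j =
     (if mu \<in> GT k \<and> inc j mu \<in> GT k then
        \<Prod>i=1..<j.
          ((1 - q powi (mu i - mu j) * t ^ (j - i - 1)) *
           (1 - q powi (mu i - mu j - 1) * t ^ (j - i + 1))) /
          ((1 - q powi (mu i - mu j) * t ^ (j - i)) *
           (1 - q powi (mu i - mu j - 1) * t ^ (j - i)))
      else 0)"

text \<open>\<open>mac_P q t a k lam\<close> is the Macdonald polynomial $P_\lambda(a_1,\dots,a_k)$; there are
  finitely many arrays with a given top level.\<close>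

definition mac_P :: "real \<Rightarrow> real \<Rightarrow> (nat \<Rightarrow> real) \<Rightarrow> nat \<Rightarrow> sig \<Rightarrow> real" where
  "mac_P q t a k lam =
     (\<Sum>X\<in>{X \<in> arrays k. X k = lam}.
        \<Prod>i=1..k. psi q t i (X i) (X (i - 1)) * a i powi (wt i (X i) - wt (i - 1) (X (i - 1))))"

definition link :: "real \<Rightarrow> real \<Rightarrow> (nat \<Rightarrow> real) \<Rightarrow> nat \<Rightarrow> sig \<Rightarrow> sig \<Rightarrow> real" where
  "link q t a k lam lam' =
     (if k = 1 then 1
      else mac_P q t a (k - 1) lam' / mac_P q t a k lam * psi q t k lam lam' *
           a k powi (wt k lam - wt (k - 1) lam'))"

definition up_rate :: "real \<Rightarrow> real \<Rightarrow> (nat \<Rightarrow> real) \<Rightarrow> nat \<Rightarrow> sig \<Rightarrow> nat \<Rightarrow> real" where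
  "up_rate q t a k lam j = mac_P q t a k (inc j lam) / mac_P q t a k lam * psi_up q t k lam j"

text \<open>In the off-diagonal case at most one \<open>j\<close> contributes.\<close>

definition Qgen :: "real \<Rightarrow> real \<Rightarrow> (nat \<Rightarrow> real) \<Rightarrow> nat \<Rightarrow> sig \<Rightarrow> sig \<Rightarrow> real" where
  "Qgen q t a k lam nu =
     (if nu = lam then - (\<Sum>j=1..k. up_rate q t a k lam j)
      else \<Sum>j\<in>{j \<in> {1..k}. nu = inc j lam}. up_rate q t a k lam j)"

definition succs :: "nat \<Rightarrow> sig \<Rightarrow> sig set" where
  "succs k lam = {nu \<in> GT k. nu = lam \<or> (\<exists>j\<in>{1..k}. nu = inc j lam)}"

text \<open>\<open>W k lam nu lam'\<close> stands for $W_k(\lambda,\nu|\bar\lambda)$ and \<open>V k lam nu lam' nu'\<close> for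
  $V_k(\lambda,\nu|\bar\lambda,\bar\nu)$. Conditions are imposed only on arguments where these
  functions are meaningful; in the last equation the values outside this domain are multiplied
  by a vanishing \<open>Qgen\<close> or \<open>link\<close>.\<close>

type_synonym jump_rates = "nat \<Rightarrow> sig \<Rightarrow> sig \<Rightarrow> sig \<Rightarrow> real"
type_synonym trigger_probs = "nat \<Rightarrow> sig \<Rightarrow> sig \<Rightarrow> sig \<Rightarrow> sig \<Rightarrow> real"

definition multivariate_dynamics ::
  "real \<Rightarrow> real \<Rightarrow> (nat \<Rightarrow> real) \<Rightarrow> nat \<Rightarrow> jump_rates \<Rightarrow> trigger_probs \<Rightarrow> bool" where
  "multivariate_dynamics q t a N W V \<longleftrightarrow> (\<forall>k\<in>{1..N}.
     (\<forall>lam lam'. interl k lam' lam \<longrightarrow>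
        (\<forall>nu\<in>GT k. nu \<notin> succs k lam \<or> \<not> interl k lam' nu \<longrightarrow> W k lam nu lam' = 0) \<and>
        (\<Sum>nu\<in>succs k lam - {lam}. W k lam nu lam') = - W k lam lam lam' \<and>
        (\<forall>nu'\<in>succs (k - 1) lam'.
           (\<forall>nu\<in>GT k. nu \<notin> succs k lam \<or> \<not> interl k nu' nu \<longrightarrow> V k lam nu lam' nu' = 0) \<and>
           (\<Sum>nu\<in>succs k lam. V k lam nu lam' nu') = 1) \<and>
        (\<forall>nu\<in>GT k. V k lam nu lam' lam' = (if lam = nu then 1 else 0))) \<and>
     (\<forall>lam\<in>GT k. \<forall>nu\<in>GT k. \<forall>nu'. interl k nu' nu \<longrightarrow>
        (\<Sum>lam'\<in>{lam'. interl k lam' lam}.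
            V k lam nu lam' nu' * link q t a k lam lam' * Qgen q t a (k - 1) lam' nu') +
        W k lam nu nu' * link q t a k lam nu'
        = Qgen q t a k lam nu * link q t a k nu nu'))"

definition free_set :: "nat \<Rightarrow> sig \<Rightarrow> sig \<Rightarrow> nat set" where
  "free_set k nu' lam = {j \<in> {1..k}. j = 1 \<or> lam j < nu' (j - 1)}"

definition xi :: "nat \<Rightarrow> sig \<Rightarrow> sig \<Rightarrow> nat \<Rightarrow> nat" where
  "xi k nu' lam i = Max {j \<in> free_set k nu' lam. j \<le> i}"

definition nearest_neighbor :: "nat \<Rightarrow> trigger_probs \<Rightarrow> bool" where
  "nearest_neighbor N V \<longleftrightarrow> (\<forall>k\<in>{2..N}. \<forall>lam nu'. interl k nu' lam \<longrightarrow>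
     (\<forall>j\<in>{1..k - 1}. j + 1 \<in> free_set k nu' lam \<longrightarrow>
        (\<forall>m\<in>{1..k}. inc m lam \<in> GT k \<and> m \<noteq> j + 1 \<and> m \<noteq> xi k nu' lam j \<longrightarrow>
           V k lam (inc m lam) (dec j nu') nu' = 0)))"

text \<open>Description of the dynamics by independent jumps and pushes assigned to all particles,
  including the blocked ones. For \<open>nu'\<close> the new state at level \<open>k - 1\<close> and \<open>lam\<close> the old state
  at level \<open>k\<close>, \<open>jmp k lam nu' j\<close> is the independent jump rate assigned to the \<open>j\<close>-th particle of
  \<open>lam\<close>, \<open>push k lam nu' j\<close> is the probability that the move of the \<open>j\<close>-th particle of \<open>nu'\<close>
  pushes the \<open>j\<close>-th particle of \<open>lam\<close>, and \<open>pull k lam nu' j\<close> is the probability that it pulls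
  the \<open>(j + 1)\<close>-st particle of \<open>lam\<close>. The actual rates \<open>W\<close> and probabilities \<open>V\<close> result from the
  donation rule: whatever is assigned to the \<open>j\<close>-th particle is executed by the particle with
  number \<open>xi k nu' lam j\<close>, which is \<open>j\<close> itself if and only if \<open>j\<close> is free. A pulled particle is
  never blocked: the old lower state \<open>dec j nu'\<close> interlaces with \<open>lam\<close>, so
  \<open>lam (j + 1) < nu' j\<close>.\<close>

type_synonym assignment = "nat \<Rightarrow> sig \<Rightarrow> sig \<Rightarrow> nat \<Rightarrow> real"

definition described_by_donation ::
  "nat \<Rightarrow> jump_rates \<Rightarrow> trigger_probs \<Rightarrow> assignment \<Rightarrow> assignment \<Rightarrow> assignment \<Rightarrow> bool" where
  "described_by_donation N W V jmp push pull \<longleftrightarrow>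
     (\<forall>k\<in>{1..N}. \<forall>lam nu'. interl k nu' lam \<longrightarrow>
        (\<forall>m\<in>free_set k nu' lam.
           W k lam (inc m lam) nu' = (\<Sum>j\<in>{j \<in> {1..k}. xi k nu' lam j = m}. jmp k lam nu' j) \<and>
           (\<forall>j\<in>{1..k - 1}. interl k (dec j nu') lam \<longrightarrow>
              V k lam (inc m lam) (dec j nu') nu' =
                (if m = j + 1 then pull k lam nu' j else 0) +
                (if m = xi k nu' lam j then push k lam nu' j else 0))))"

definition no_donations :: "nat \<Rightarrow> assignment \<Rightarrow> assignment \<Rightarrow> bool" where
  "no_donations N jmp push \<longleftrightarrow>
     (\<forall>k\<in>{2..N}. \<forall>lam nu'. interl k nu' lam \<longrightarrow>
        (\<forall>j\<in>{2..k}. lam j = nu' (j - 1) \<longrightarrow>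
           jmp k lam nu' j = 0 \<and>
           (j \<le> k - 1 \<and> interl k (dec j nu') lam \<longrightarrow> push k lam nu' j = 0)))"

text \<open>The functions at level \<open>k\<close> only see levels \<open>k\<close> and \<open>k - 1\<close>, so not depending on the
  particles other than the rightmost ones means being determined by \<open>lam 1\<close> and \<open>nu' 1\<close>. For
  \<open>k = 1\<close> the lower state is the empty signature and \<open>nu' 1 = 0\<close> carries no information.\<close>

definition rightmost_jumps_autonomous :: "nat \<Rightarrow> jump_rates \<Rightarrow> bool" where
  "rightmost_jumps_autonomous N W \<longleftrightarrow>
     (\<forall>k\<in>{1..N}. \<forall>lam nu' mu kap'. interl k nu' lam \<and> interl k kap' mu \<and>
        lam 1 = mu 1 \<and> nu' 1 = kap' 1 \<longrightarrow>
        W k lam (inc 1 lam) nu' = W k mu (inc 1 mu) kap')"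

definition rightmost_pushes_autonomous :: "nat \<Rightarrow> trigger_probs \<Rightarrow> bool" where
  "rightmost_pushes_autonomous N V \<longleftrightarrow>
     (\<forall>k\<in>{2..N}. \<forall>lam nu' mu kap'.
        interl k nu' lam \<and> interl k (dec 1 nu') lam \<and>
        interl k kap' mu \<and> interl k (dec 1 kap') mu \<and>
        lam 1 = mu 1 \<and> nu' 1 = kap' 1 \<longrightarrow>
        V k lam (inc 1 lam) (dec 1 nu') nu' = V k mu (inc 1 mu) (dec 1 kap') kap')"

end

theory Submission
  imports Defs
begin

text \<open>At \<open>t = 0\<close> the skew coefficient \<open>psi\<close> is a product of \<open>q\<close>-binomial coefficients. Without
  donations only \<open>nu' 1\<close> can make \<open>lam 1\<close> move, so the commutation relation for the move
  \<open>lam \<mapsto> inc 1 lam\<close> reduces, with \<open>r = lam 1 - nu' 1\<close>, to a single equation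
  \[ a_k (1 - q^{\nu'_1 - \lambda_2})\, V + (1 - q^{r+1})\, W = a_k (1 - q^{\lambda_1 - \lambda_2 + 1}). \]
  The second particle can be placed at \<open>lam 2 = nu' 1\<close>, where the first term vanishes and
  \<open>W = a k\<close>; as \<open>W\<close> does not see \<open>lam 2\<close>, this holds everywhere, and then \<open>V = q powi (r + 1)\<close>.\<close>

section \<open>Interlacing signatures\<close>

lemma inc_dec [simp]: "inc j (dec j lam) = lam"
  by (auto simp: inc_def dec_def)

lemma dec_inc [simp]: "dec j (inc j lam) = lam"
  by (auto simp: inc_def dec_def)

lemma inc_neq [simp]: "inc j lam \<noteq> lam" "lam \<noteq> inc j lam"
  by (auto simp: inc_def fun_upd_def fun_eq_iff)

lemma inc_eq_inc_iff [simp]: "inc i lam = inc j lam \<longleftrightarrow> i = j"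
  by (auto simp: inc_def fun_eq_iff split: if_splits)

lemma wt_inc:
  assumes "j \<in> {1..k}"
  shows "wt k (inc j lam) = wt k lam + 1"
proof -
  have "wt k (inc j lam) = (\<Sum>i=1..k. lam i + (if i = j then 1 else 0))"
    unfolding wt_def inc_def by (intro sum.cong) auto
  with assms show ?thesis
    by (simp add: wt_def sum.distrib)
qed

lemma inc_1_GT:
  assumes "lam \<in> GT k" "1 \<le> k"
  shows "inc 1 lam \<in> GT k"
proof -
  have "inc 1 lam (i + 1) \<le> inc 1 lam i" if "i \<in> {1..<k}" for i
  proof -
    have "inc 1 lam (i + 1) = lam (i + 1)" "lam i \<le> inc 1 lam i"
      using that by (auto simp: inc_def)
    with assms that show ?thesis
      unfolding GT_def by fastforce
  qed
  moreover have "inc 1 lam i = 0" if "i \<notin> {1..k}" for i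
    using assms that by (auto simp: GT_def inc_def)
  ultimately show ?thesis by (simp add: GT_def)
qed

text \<open>From the level below, the rightmost particle is bounded only from the left by
  \<open>nu' 1\<close>, so moving it right is never obstructed.\<close>

lemma interl_inc_1:
  assumes "interl k nu' lam"
  shows "interl k nu' (inc 1 lam)"
proof -
  have "inc 1 lam \<in> GT k"
    using assms by (intro inc_1_GT) (auto simp: interl_def)
  moreover have "lam i \<le> inc 1 lam i" "inc 1 lam (i + 1) = lam (i + 1)" if "1 \<le> i" for i
    using that by (auto simp: inc_def)
  ultimately show ?thesis
    using assms unfolding interl_def by (metis atLeastAtMost_iff order_trans)
qed

lemma finite_interl: "finite {lam'. interl k lam' lam}"
proof -
  \<comment> \<open>\<open>finite_set_of_finite_funs\<close> asks for one finite codomain common to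
    all positions, hence the union of the intervals.\<close>
  let ?B = "\<Union>i\<in>{1..k - 1}. {lam (i + 1)..lam i}"
  have "finite {f. \<forall>i. (i \<in> {1..k - 1} \<longrightarrow> f i \<in> ?B) \<and> (i \<notin> {1..k - 1} \<longrightarrow> f i = 0)}"
    by (rule finite_set_of_finite_funs) auto
  moreover have "{lam'. interl k lam' lam} \<subseteq>
      {f. \<forall>i. (i \<in> {1..k - 1} \<longrightarrow> f i \<in> ?B) \<and> (i \<notin> {1..k - 1} \<longrightarrow> f i = 0)}"
    unfolding interl_def GT_def by fastforce
  ultimately show ?thesis by (rule rev_finite_subset)
qed

text \<open>This makes \<open>mac_P\<close> a genuine sum, since a sum over an infinite set would be
  \<open>0\<close> by convention. The induction removes the top level.\<close>

lemma finite_arrays: "finite {X \<in> arrays k. X k = lam}"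
proof (induction k arbitrary: lam)
  case 0
  have "{X \<in> arrays 0. X 0 = lam} \<subseteq> {\<lambda>_ _. 0}"
    by (auto simp: arrays_def)
  then show ?case by (rule finite_subset) simp
next
  case (Suc k)
  have "{X \<in> arrays (Suc k). X (Suc k) = lam} \<subseteq>
     (\<lambda>X. X(Suc k := lam)) ` (\<Union>lam'\<in>{lam'. interl (Suc k) lam' lam}. {X \<in> arrays k. X k = lam'})"
  proof
    fix X assume X: "X \<in> {X \<in> arrays (Suc k). X (Suc k) = lam}"
    \<comment> \<open>Members of \<open>arrays k\<close> vanish above level \<open>k\<close>, so the
      removed level is reset to zero.\<close>
    define Y where "Y = X(Suc k := (\<lambda>_. 0))"
    from X have "interl (Suc k) (X (Suc k - 1)) (X (Suc k))"
      unfolding arrays_def by fastforce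
    then have "Y \<in> arrays k" "interl (Suc k) (Y k) lam" "X = Y(Suc k := lam)"
      using X by (auto simp: Y_def arrays_def)
    then show "X \<in> (\<lambda>X. X(Suc k := lam)) `
        (\<Union>lam'\<in>{lam'. interl (Suc k) lam' lam}. {X \<in> arrays k. X k = lam'})"
      by blast
  qed
  then show ?case
    by (rule finite_subset) (use Suc finite_interl in auto)
qed

lemma arrays_nonempty:
  assumes "lam \<in> GT k"
  shows "{X \<in> arrays k. X k = lam} \<noteq> {}"
proof -
  \<comment> \<open>Level \<open>m\<close> is \<open>lam\<close> truncated to its first
    \<open>m\<close> entries; consecutive truncations interlace because \<open>lam\<close> is weakly
    decreasing.\<close>
  define X where "X m i = (if m \<le> k \<and> i \<in> {1..m} then lam i else 0)" for m i
  have "\<And>i. i \<notin> {1..k} \<Longrightarrow> lam i = 0"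
    and "\<And>i. 1 \<le> i \<Longrightarrow> i < k \<Longrightarrow> lam (Suc i) \<le> lam i"
    using assms by (auto simp: GT_def)
  then have "X \<in> arrays k" "X k = lam"
    by (auto simp: arrays_def interl_def GT_def X_def fun_eq_iff)
  then show ?thesis by auto
qed

section \<open>Branching coefficients at \<open>t = 0\<close>\<close>

lemma powi_less_one:
  assumes "0 < q" "q < (1::real)" "0 < n"
  shows "q powi n < 1"
  using assms by (simp add: power_int_def power_less_one_iff)

lemma qpoch_factor_pos:
  assumes "0 \<le> q" "q < 1" "b < (1::real)"
  shows "1 - b * q ^ i > 0"
proof (cases "b \<ge> 0")
  case True
  have "b * q ^ i \<le> b * 1"
    using assms True by (intro mult_left_mono power_le_one) auto
  with assms show ?thesis by simp
next
  case False
  then have "b * q ^ i \<le> 0"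
    using assms by (intro mult_nonpos_nonneg) auto
  then show ?thesis by simp
qed

lemma convergent_qpoch:
  assumes "0 \<le> q" "q < 1" "b < (1::real)"
  shows "convergent_prod (\<lambda>i. 1 - b * q ^ i)"
proof -
  have "summable (\<lambda>i. \<bar>- b * q ^ i\<bar>)"
    using assms by (auto simp: abs_mult power_abs intro!: summable_mult summable_geometric)
  moreover have "- b * q ^ i \<noteq> - 1" for i
    using qpoch_factor_pos[OF assms, of i] by auto
  ultimately show ?thesis
    using summable_imp_convergent_prod_real[of "\<lambda>i. - b * q ^ i"] by simp
qed

lemma qpoch_inf_0 [simp]: "qpoch_inf q 0 = 1"
  by (simp add: qpoch_inf_def)

lemma qpoch_inf_pos:
  assumes "0 \<le> q" "q < 1" "b < 1"
  shows "qpoch_inf q b > 0"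
  unfolding qpoch_inf_def
  by (rule less_0_prodinf[OF convergent_qpoch[OF assms] qpoch_factor_pos[OF assms]])

lemma qpoch_inf_rec:
  assumes "0 \<le> q" "q < 1" "b < 1"
  shows "qpoch_inf q b = (1 - b) * qpoch_inf q (q * b)"
  using prodinf_split_head[OF convergent_qpoch[OF assms]] qpoch_factor_pos[OF assms, of 0]
  by (simp add: qpoch_inf_def mult_ac)

lemma mac_f_0_0 [simp]: "mac_f q 0 0 = 1"
  by (simp add: mac_f_def)

lemma mac_f_pos:
  assumes "0 < q" "q < 1" "n \<ge> 0"
  shows "mac_f q 0 (q powi n) > 0"
proof -
  have "q * q powi n < 1"
    using assms powi_less_one[of q "n + 1"] by (simp add: power_int_add_1')
  with assms show ?thesis
    by (simp add: mac_f_def qpoch_inf_pos)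
qed

text \<open>At \<open>t = 0\<close> the numerator of \<open>mac_f\<close> is \<open>1\<close>, and
  peeling off the first factor of the denominator gives the recursion. Thus
  \<open>mac_f q 0 (q powi n)\<close> is the q-factorial $(q;q)_n$ up to a factor independent of
  \<open>n\<close>.\<close>

lemma mac_f_Suc:
  assumes "0 < q" "q < 1" "n \<ge> 0"
  shows "mac_f q 0 (q powi (n + 1)) = (1 - q powi (n + 1)) * mac_f q 0 (q powi n)"
proof -
  have *: "q powi (n + 1) = q * q powi n"
    using assms by (simp add: power_int_add_1')
  have "q * (q * q powi n) = q powi (n + 2)"
    using assms by (simp add: power_int_add power2_eq_square)
  with assms have "qpoch_inf q (q * (q * q powi n)) > 0"
    by (simp add: qpoch_inf_pos powi_less_one)
  moreover have "q * q powi n < 1"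
    using assms powi_less_one[of q "n + 1"] * by simp
  ultimately show ?thesis
    using assms qpoch_inf_rec[of q "q * q powi n"] by (simp add: mac_f_def *)
qed

text \<open>For interlacing arguments this is the q-binomial coefficient of
  \<open>nu j - nu (j + 1)\<close> over \<open>nu j - kap j\<close>. The value at
  \<open>q powi 0\<close> comes from the difference \<open>kap j - kap j\<close> and cancels the
  constants of the q-factorials.\<close>

definition psi_fac :: "real \<Rightarrow> sig \<Rightarrow> sig \<Rightarrow> nat \<Rightarrow> real" where
  "psi_fac q nu kap j =
     mac_f q 0 (q powi 0) * mac_f q 0 (q powi (nu j - nu (j + 1))) /
     (mac_f q 0 (q powi (nu j - kap j)) * mac_f q 0 (q powi (kap j - nu (j + 1))))"

text \<open>For \<open>i < j\<close> the power \<open>0 ^ (j - i)\<close> turns every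
  \<open>mac_f\<close> into \<open>mac_f q 0 0 = 1\<close>; only the diagonal \<open>i = j\<close>,
  where \<open>0 ^ 0 = 1\<close>, survives.\<close>

lemma psi_t0:
  assumes "interl m kap nu"
  shows "psi q 0 m nu kap = (\<Prod>j=1..m - 1. psi_fac q nu kap j)"
proof -
  let ?g = "\<lambda>i j. (mac_f q 0 (q powi (kap i - kap j) * 0 ^ (j - i)) *
           mac_f q 0 (q powi (nu i - nu (j + 1)) * 0 ^ (j - i))) /
          (mac_f q 0 (q powi (nu i - kap j) * 0 ^ (j - i)) *
           mac_f q 0 (q powi (kap i - nu (j + 1)) * 0 ^ (j - i)))"
  have "(\<Prod>i=1..j. ?g i j) = psi_fac q nu kap j" if "j \<in> {1..m - 1}" for j
  proof -
    have "(\<Prod>i=1..j. ?g i j) = ?g j j * (\<Prod>i\<in>{1..j} - {j}. ?g i j)"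
      using that by (subst prod.remove[of _ j]) auto
    also have "(\<Prod>i\<in>{1..j} - {j}. ?g i j) = 1"
      by (rule prod.neutral) (auto simp: power_0_left)
    finally show ?thesis by (simp add: psi_fac_def)
  qed
  then show ?thesis
    using assms unfolding psi_def by (auto intro!: prod.cong)
qed

lemma psi_fac_pos:
  assumes "0 < q" "q < 1" "nu (j + 1) \<le> kap j" "kap j \<le> nu j"
  shows "psi_fac q nu kap j > 0"
  using assms unfolding psi_fac_def by (intro divide_pos_pos mult_pos_pos mac_f_pos) auto

lemma psi_t0_pos:
  assumes "0 < q" "q < 1" "interl m kap nu"
  shows "psi q 0 m nu kap > 0"
  unfolding psi_t0[OF assms(3)]
  by (intro prod_pos psi_fac_pos assms) (use assms in \<open>auto simp: interl_def\<close>)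

text \<open>Only the factor \<open>j = 1\<close> sees \<open>nu 1\<close>; there one q-factorial in
  the numerator and one in the denominator grow by a step. Cross-multiplication avoids a
  quotient.\<close>

lemma psi_inc_1:
  assumes q: "0 < q" "q < 1" and "k \<ge> 2" and il: "interl k kap nu"
  shows "psi q 0 k (inc 1 nu) kap * (1 - q powi (nu 1 - kap 1 + 1)) =
         psi q 0 k nu kap * (1 - q powi (nu 1 - nu 2 + 1))"
proof -
  have le: "nu 2 \<le> kap 1" "kap 1 \<le> nu 1"
    using il \<open>k \<ge> 2\<close> by (force simp: interl_def numeral_2_eq_2)+
  have split: "prod f {1..k - 1} = f 1 * prod f ({1..k - 1} - {1})" for f :: "nat \<Rightarrow> real"
    using \<open>k \<ge> 2\<close> by (subst prod.remove[of _ 1]) auto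
  have rest: "(\<Prod>j\<in>{1..k - 1} - {1}. psi_fac q (inc 1 nu) kap j) =
              (\<Prod>j\<in>{1..k - 1} - {1}. psi_fac q nu kap j)"
    by (rule prod.cong) (auto simp: psi_fac_def inc_def)
  define F where "F n = mac_f q 0 (q powi n)" for n
  have F: "F (n + 1) = (1 - q powi (n + 1)) * F n" if "n \<ge> 0" for n
    using mac_f_Suc[OF q that] by (simp add: F_def)
  have "psi_fac q (inc 1 nu) kap 1 =
      F 0 * F (nu 1 - nu 2 + 1) / (F (nu 1 - kap 1 + 1) * F (kap 1 - nu 2))"
    by (simp add: psi_fac_def inc_def F_def numeral_2_eq_2 algebra_simps)
  moreover have "psi_fac q nu kap 1 =
      F 0 * F (nu 1 - nu 2) / (F (nu 1 - kap 1) * F (kap 1 - nu 2))"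
    by (simp add: psi_fac_def F_def numeral_2_eq_2)
  moreover have "1 - q powi (nu 1 - kap 1 + 1) \<noteq> 0"
    using q le powi_less_one[of q "nu 1 - kap 1 + 1"] by simp
  ultimately have "psi_fac q (inc 1 nu) kap 1 * (1 - q powi (nu 1 - kap 1 + 1)) =
      psi_fac q nu kap 1 * (1 - q powi (nu 1 - nu 2 + 1))"
    using le F[of "nu 1 - kap 1"] F[of "nu 1 - nu 2"] by simp
  with rest show ?thesis
    unfolding psi_t0[OF il] psi_t0[OF interl_inc_1[OF il]] split
    by (simp add: mult_ac)
qed

lemma psi_dec_1:
  assumes q: "0 < q" "q < 1" and "k \<ge> 2" and il: "interl k kap nu" and il': "interl k (dec 1 kap) nu"
  shows "psi q 0 k nu (dec 1 kap) * (1 - q powi (nu 1 - kap 1 + 1)) =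
         psi q 0 k nu kap * (1 - q powi (kap 1 - nu 2))"
proof -
  \<comment> \<open>The strict gap between \<open>nu 2\<close> and \<open>kap 1\<close> comes from
    \<open>il'\<close>; it makes the recursion for \<open>F\<close> applicable at
    \<open>kap 1 - nu 2 - 1\<close>.\<close>
  have le: "nu 2 \<le> kap 1 - 1" "kap 1 \<le> nu 1"
    using il il' \<open>k \<ge> 2\<close> by (force simp: interl_def numeral_2_eq_2 dec_def)+
  have split: "prod f {1..k - 1} = f 1 * prod f ({1..k - 1} - {1})" for f :: "nat \<Rightarrow> real"
    using \<open>k \<ge> 2\<close> by (subst prod.remove[of _ 1]) auto
  have rest: "(\<Prod>j\<in>{1..k - 1} - {1}. psi_fac q nu (dec 1 kap) j) =
              (\<Prod>j\<in>{1..k - 1} - {1}. psi_fac q nu kap j)"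
    by (rule prod.cong) (auto simp: psi_fac_def dec_def)
  define F where "F n = mac_f q 0 (q powi n)" for n
  have F: "F (n + 1) = (1 - q powi (n + 1)) * F n" if "n \<ge> 0" for n
    using mac_f_Suc[OF q that] by (simp add: F_def)
  have "psi_fac q nu (dec 1 kap) 1 =
      F 0 * F (nu 1 - nu 2) / (F (nu 1 - kap 1 + 1) * F (kap 1 - nu 2 - 1))"
    by (simp add: psi_fac_def dec_def F_def numeral_2_eq_2 algebra_simps)
  moreover have "psi_fac q nu kap 1 =
      F 0 * F (nu 1 - nu 2) / (F (nu 1 - kap 1) * F (kap 1 - nu 2))"
    by (simp add: psi_fac_def F_def numeral_2_eq_2)
  moreover have "1 - q powi (nu 1 - kap 1 + 1) \<noteq> 0" "1 - q powi (kap 1 - nu 2) \<noteq> 0"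
    using q le powi_less_one[of q "nu 1 - kap 1 + 1"] powi_less_one[of q "kap 1 - nu 2"] by simp_all
  ultimately have "psi_fac q nu (dec 1 kap) 1 * (1 - q powi (nu 1 - kap 1 + 1)) =
      psi_fac q nu kap 1 * (1 - q powi (kap 1 - nu 2))"
    using le F[of "nu 1 - kap 1"] F[of "kap 1 - nu 2 - 1"] by simp
  with rest show ?thesis
    unfolding psi_t0[OF il] psi_t0[OF il'] split
    by (simp add: mult_ac)
qed

text \<open>All summands are positive and at least one array exists. Hence the quotients in
  \<open>link\<close> and \<open>Qgen\<close> have nonzero denominators and can be
  cancelled.\<close>

lemma mac_P_t0_pos:
  assumes "0 < q" "q < 1" "lam \<in> GT k" "\<And>i. i \<in> {1..k} \<Longrightarrow> a i > 0"
  shows "mac_P q 0 a k lam > 0"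
  unfolding mac_P_def
proof (rule sum_pos[OF finite_arrays arrays_nonempty[OF assms(3)]])
  fix X assume "X \<in> {X \<in> arrays k. X k = lam}"
  then show "(\<Prod>i=1..k. psi q 0 i (X i) (X (i - 1)) *
      a i powi (wt i (X i) - wt (i - 1) (X (i - 1)))) > 0"
    by (intro prod_pos ballI mult_pos_pos psi_t0_pos zero_less_power_int assms)
      (auto simp: arrays_def)
qed

text \<open>For the first coordinate the product in \<open>psi_up\<close> is empty, so only the
  ratio of Macdonald polynomials remains.\<close>

lemma Qgen_inc_1:
  assumes "lam \<in> GT k" "1 \<le> k"
  shows "Qgen q t a k lam (inc 1 lam) = mac_P q t a k (inc 1 lam) / mac_P q t a k lam"
proof -
  have "{j \<in> {1..k}. inc 1 lam = inc j lam} = {1}"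
    using assms by auto
  then show ?thesis
    using assms inc_1_GT[OF assms]
    by (simp add: Qgen_def up_rate_def psi_up_def)
qed

section \<open>The rightmost particles\<close>

lemma xi_free: "j \<in> free_set k nu' lam \<Longrightarrow> xi k nu' lam j = j"
  unfolding xi_def by (rule Max_eqI) (auto simp: free_set_def)

text \<open>A pull by particle \<open>j\<close> acts on \<open>j + 1\<close>, never on
  \<open>1\<close>. A push by \<open>j\<close> acts on \<open>j\<close> itself if that particle is
  free; otherwise it would be a donation, which is excluded.\<close>

lemma V_rightmost_zero:
  assumes R3: "described_by_donation N W V jmp push pull" "no_donations N jmp push"
    and "k \<in> {2..N}" and il: "interl k nu' lam" and il': "interl k (dec j nu') lam"
    and j: "j \<in> {2..k - 1}"
  shows "V k lam (inc 1 lam) (dec j nu') nu' = 0"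
proof -
  have "1 \<in> free_set k nu' lam"
    using \<open>k \<in> {2..N}\<close> by (auto simp: free_set_def)
  then have V: "V k lam (inc 1 lam) (dec j nu') nu' =
      (if 1 = xi k nu' lam j then push k lam nu' j else 0)"
    using R3(1) il il' j \<open>k \<in> {2..N}\<close> unfolding described_by_donation_def by auto
  show ?thesis
  proof (cases "j \<in> free_set k nu' lam")
    case True
    with V j show ?thesis by (simp add: xi_free)
  next
    case False
    have "j - 1 \<in> {1..k - 1}" "j - 1 + 1 = j"
      using j by auto
    \<comment> \<open>Together with not being free, interlacing leaves equality, which is the
      blocking condition in \<open>no_donations\<close>.\<close>
    then have "lam j \<le> nu' (j - 1)"
      using il unfolding interl_def by metis
    with False j have "lam j = nu' (j - 1)"
      by (auto simp: free_set_def)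
    then have "push k lam nu' j = 0"
      using R3(2) il il' j \<open>k \<in> {2..N}\<close> unfolding no_donations_def by auto
    with V show ?thesis by simp
  qed
qed

lemma rightmost_equation:
  assumes q: "0 < q" "q < 1" and a: "\<forall>k\<in>{1..N}. a k > 0"
    and dynamics: "multivariate_dynamics q 0 a N W V"
    and R3: "described_by_donation N W V jmp push pull" "no_donations N jmp push"
    and k: "k \<in> {2..N}" and il: "interl k nu' lam"
  shows "(if interl k (dec 1 nu') lam
          then a k * V k lam (inc 1 lam) (dec 1 nu') nu' * (1 - q powi (nu' 1 - lam 2)) else 0) +
         W k lam (inc 1 lam) nu' * (1 - q powi (lam 1 - nu' 1 + 1)) =
         a k * (1 - q powi (lam 1 - lam 2 + 1))"
proof -
  let ?P = "mac_P q 0 a" and ?c = "a k powi (wt k lam - wt (k - 1) nu')"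
  let ?T = "\<lambda>lam'. V k lam (inc 1 lam) lam' nu' * link q 0 a k lam lam' * Qgen q 0 a (k - 1) lam' nu'"
  have kN: "k \<in> {1..N}" "k \<noteq> 1" "1 \<le> k" "2 \<le> k" and ak: "a k > 0"
    using k a by auto
  have GT: "lam \<in> GT k" "nu' \<in> GT (k - 1)"
    using il by (auto simp: interl_def)
  have P_pos: "?P k lam > 0" "?P k (inc 1 lam) > 0" "?P (k - 1) nu' > 0"
    using k a GT inc_1_GT[of lam k] by (auto intro!: mac_P_t0_pos q)
  have "sum ?T {lam'. interl k lam' lam} =
      (\<Sum>lam'\<in>{lam'. interl k lam' lam}. if dec 1 nu' = lam' then ?T (dec 1 nu') else 0)"
  proof (rule sum.cong[OF refl])
    fix lam' assume "lam' \<in> {lam'. interl k lam' lam}"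
    then have il': "interl k lam' lam" by simp
    \<comment> \<open>The old lower state did not move, moved a particle other than the first, moved
      the first, or cannot reach \<open>nu'\<close> in one step. Only the third case contributes:
      \<open>V\<close> vanishes in the first two, \<open>Qgen\<close> in the last.\<close>
    consider "lam' = nu'" | "\<exists>j\<in>{2..k - 1}. lam' = dec j nu'" | "lam' = dec 1 nu'"
      | "lam' \<noteq> nu'" "\<forall>j\<in>{1..k - 1}. nu' \<noteq> inc j lam'"
      by (metis Suc_1 Suc_leI atLeastAtMost_iff dec_inc le_neq_implies_less)
    then show "?T lam' = (if dec 1 nu' = lam' then ?T (dec 1 nu') else 0)"
    proof cases
      case 1
      then have "V k lam (inc 1 lam) lam' nu' = 0"
        using dynamics kN il inc_1_GT[OF GT(1)]
        unfolding multivariate_dynamics_def by auto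
      then show ?thesis by auto
    next
      case 2
      then have "V k lam (inc 1 lam) lam' nu' = 0"
        using V_rightmost_zero[OF R3 k il] il' by auto
      then show ?thesis by auto
    next
      case 3
      then show ?thesis by simp
    next
      case 4
      then have "Qgen q 0 a (k - 1) lam' nu' = 0"
        unfolding Qgen_def by (auto intro!: sum.neutral)
      then show ?thesis by auto
    qed
  qed
  also have "\<dots> = (if interl k (dec 1 nu') lam then ?T (dec 1 nu') else 0)"
    by (simp add: finite_interl)
  finally have sum_T: "sum ?T {lam'. interl k lam' lam} = \<dots>" .
  \<comment> \<open>The polynomial at \<open>dec 1 nu'\<close> cancels between \<open>link\<close>
    and \<open>Qgen\<close>; its weight, smaller by one, produces the extra
    \<open>a k\<close>.\<close>
  have T: "?T (dec 1 nu') = V k lam (inc 1 lam) (dec 1 nu') nu' * psi q 0 k lam (dec 1 nu') *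
      ?c * a k * (?P (k - 1) nu' / ?P k lam)" if "interl k (dec 1 nu') lam"
  proof -
    have GT': "dec 1 nu' \<in> GT (k - 1)"
      using that by (auto simp: interl_def)
    have wt: "wt (k - 1) nu' = wt (k - 1) (dec 1 nu') + 1"
      using wt_inc[of 1 "k - 1" "dec 1 nu'"] k by fastforce
    have "?P (k - 1) (dec 1 nu') > 0"
      using k a GT' by (intro mac_P_t0_pos q) auto
    moreover have "Qgen q 0 a (k - 1) (dec 1 nu') nu' = ?P (k - 1) nu' / ?P (k - 1) (dec 1 nu')"
      using Qgen_inc_1[OF GT', of q 0 a] k by fastforce
    moreover have "a k powi (wt k lam - wt (k - 1) (dec 1 nu')) = ?c * a k"
    proof -
      have "wt k lam - wt (k - 1) (dec 1 nu') = (wt k lam - wt (k - 1) nu') + 1"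
        using wt by simp
      then show ?thesis
        using ak by (simp only:) (rule power_int_add_1, simp)
    qed
    ultimately show ?thesis
      using kN by (simp add: link_def)
  qed
  have S: "sum ?T {lam'. interl k lam' lam} = (if interl k (dec 1 nu') lam
      then V k lam (inc 1 lam) (dec 1 nu') nu' * psi q 0 k lam (dec 1 nu') *
      ?c * a k * (?P (k - 1) nu' / ?P k lam) else 0)"
    unfolding sum_T by (rule if_cong[OF refl T refl])
  have "a k powi (wt k (inc 1 lam) - wt (k - 1) nu') = ?c * a k"
    using ak wt_inc[of 1 k lam] kN power_int_add_1[of "a k" "wt k lam - wt (k - 1) nu'"]
    by (simp add: algebra_simps)
  then have "Qgen q 0 a k lam (inc 1 lam) * link q 0 a k (inc 1 lam) nu' =
      psi q 0 k (inc 1 lam) nu' * ?c * a k * (?P (k - 1) nu' / ?P k lam)"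
    using Qgen_inc_1[OF GT(1), of q 0 a] kN P_pos by (simp add: link_def)
  moreover have "link q 0 a k lam nu' = psi q 0 k lam nu' * ?c * (?P (k - 1) nu' / ?P k lam)"
    using kN by (simp add: link_def)
  moreover have "sum ?T {lam'. interl k lam' lam} + W k lam (inc 1 lam) nu' * link q 0 a k lam nu' =
      Qgen q 0 a k lam (inc 1 lam) * link q 0 a k (inc 1 lam) nu'"
    using dynamics kN(1) GT(1) inc_1_GT[OF GT(1) kN(3)] interl_inc_1[OF il]
    unfolding multivariate_dynamics_def by blast
  \<comment> \<open>All terms share a nonzero factor made of \<open>?c\<close> and the ratio of
    polynomials; once it is cancelled, only branching coefficients remain.\<close>
  ultimately have "((if interl k (dec 1 nu') lam
        then V k lam (inc 1 lam) (dec 1 nu') nu' * psi q 0 k lam (dec 1 nu') * a k else 0) +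
      W k lam (inc 1 lam) nu' * psi q 0 k lam nu') * (?c * (?P (k - 1) nu' / ?P k lam)) =
      (psi q 0 k (inc 1 lam) nu' * a k) * (?c * (?P (k - 1) nu' / ?P k lam))"
    unfolding S by (auto simp: algebra_simps)
  moreover have "?c * (?P (k - 1) nu' / ?P k lam) \<noteq> 0"
    using P_pos ak by (simp add: power_int_eq_0_iff)
  ultimately have E: "(if interl k (dec 1 nu') lam
        then V k lam (inc 1 lam) (dec 1 nu') nu' * psi q 0 k lam (dec 1 nu') * a k else 0) +
      W k lam (inc 1 lam) nu' * psi q 0 k lam nu' = psi q 0 k (inc 1 lam) nu' * a k"
    using mult_right_cancel by blast
  \<comment> \<open>Multiplying \<open>E\<close> by this factor lets \<open>psi_dec_1\<close> and
    \<open>psi_inc_1\<close> express everything through the positive number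
    \<open>psi q 0 k lam nu'\<close>.\<close>
  have "psi q 0 k lam nu' * ((if interl k (dec 1 nu') lam
          then a k * V k lam (inc 1 lam) (dec 1 nu') nu' * (1 - q powi (nu' 1 - lam 2)) else 0) +
         W k lam (inc 1 lam) nu' * (1 - q powi (lam 1 - nu' 1 + 1))) =
      (psi q 0 k (inc 1 lam) nu' * a k) * (1 - q powi (lam 1 - nu' 1 + 1))"
    unfolding E[symmetric] using psi_dec_1[OF q kN(4) il] by (auto simp: distrib_left distrib_right mult_ac)
  also have "\<dots> = psi q 0 k lam nu' * (a k * (1 - q powi (lam 1 - lam 2 + 1)))"
    using psi_inc_1[OF q kN(4) il] by (simp add: mult_ac)
  finally show ?thesis
    using psi_t0_pos[OF q il] by simp
qed

text \<open>The one-variable polynomial is the monomial \<open>a 1 powi mu 1\<close>, so the rate in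
  \<open>Qgen\<close> is \<open>a 1\<close>, and no move below can trigger anything.\<close>

lemma W_rightmost_level_1:
  assumes q: "0 < q" "q < 1" and "1 \<le> N" and a: "\<forall>k\<in>{1..N}. a k > 0"
    and dynamics: "multivariate_dynamics q 0 a N W V"
    and il: "interl 1 nu' lam"
  shows "W 1 lam (inc 1 lam) nu' = a 1"
proof -
  have GT: "lam \<in> GT 1" "inc 1 lam \<in> GT 1"
    using il inc_1_GT[of lam 1] by (auto simp: interl_def)
  have one: "1 \<in> {1..N}" and a1: "a 1 > 0"
    using \<open>1 \<le> N\<close> a by auto
  have P: "mac_P q 0 a 1 mu = a 1 powi mu 1" if "mu \<in> GT 1" for mu
  proof -
    have "interl 1 (\<lambda>_. 0) mu"
      using that by (auto simp: interl_def GT_def)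
    moreover from this have "{X \<in> arrays 1. X 1 = mu} = {(\<lambda>_ _. 0)(1 := mu)}"
      by (auto simp: arrays_def)
    ultimately show ?thesis
      by (simp add: mac_P_def psi_def wt_def)
  qed
  have "Qgen q 0 a 1 lam (inc 1 lam) = a 1"
    unfolding Qgen_inc_1[OF GT(1) order_refl] P[OF GT(1)] P[OF GT(2)]
    using a1 by (simp add: inc_def power_int_add_1)
  \<comment> \<open>Both branches of \<open>Qgen\<close> sum over subsets of the empty range
    \<open>{1..0}\<close>.\<close>
  moreover have "Qgen q 0 a 0 lam' nu' = 0" for lam'
    by (simp add: Qgen_def)
  moreover have "(\<Sum>lam'\<in>{lam'. interl 1 lam' lam}.
        V 1 lam (inc 1 lam) lam' nu' * link q 0 a 1 lam lam' * Qgen q 0 a (1 - 1) lam' nu') +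
      W 1 lam (inc 1 lam) nu' * link q 0 a 1 lam nu' =
      Qgen q 0 a 1 lam (inc 1 lam) * link q 0 a 1 (inc 1 lam) nu'"
    using dynamics one GT interl_inc_1[OF il] unfolding multivariate_dynamics_def by blast
  ultimately show ?thesis
    by (simp add: link_def)
qed

text \<open>In the second clause \<open>lam'\<close> is the lower state before its move, so the
  exponent is free of the \<open>+ 1\<close> that appears in \<open>rightmost_equation\<close>,
  where \<open>nu'\<close> is the state after it. Propagation is expressed as positivity of the
  product of consecutive push probabilities.\<close>

theorem proposition8p6:
  fixes q :: real and a :: "nat \<Rightarrow> real" and N :: nat
    and W :: jump_rates and V :: trigger_probs
    and jmp push pull :: assignment
  assumes "0 < q" and "q < 1" and "N \<ge> 1" and "\<forall>k\<in>{1..N}. a k > 0"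
    and dynamics: "multivariate_dynamics q 0 a N W V"
    and nn: "nearest_neighbor N V"
    and R1: "rightmost_jumps_autonomous N W"
    and R2: "rightmost_pushes_autonomous N V"
    and R3: "described_by_donation N W V jmp push pull" "no_donations N jmp push"
  shows "(\<forall>k\<in>{1..N}. \<forall>lam nu'. interl k nu' lam \<longrightarrow> W k lam (inc 1 lam) nu' = a k) \<and>
    (\<forall>k\<in>{2..N}. \<forall>lam lam'. interl k lam' lam \<longrightarrow>
       V k lam (inc 1 lam) lam' (inc 1 lam') = q powi (lam 1 - lam' 1)) \<and>
    (\<forall>X\<in>arrays N. \<forall>k m. 1 \<le> k \<and> k < m \<and> m \<le> N \<longrightarrow>
       (\<Prod>i=k+1..m. V i (X i) (inc 1 (X i)) (X (i - 1)) (inc 1 (X (i - 1)))) > 0)"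
proof -
  note eqn = rightmost_equation[OF assms(1,2,4) dynamics R3]
  have W: "W k lam (inc 1 lam) nu' = a k" if k: "k \<in> {1..N}" and il: "interl k nu' lam" for k lam nu'
  proof (cases "k = 1")
    case True
    then show ?thesis
      using W_rightmost_level_1[OF assms(1-4) dynamics] il by simp
  next
    case False
    with k have k2: "k \<in> {2..N}" by auto
    \<comment> \<open>The test configuration keeps both rightmost coordinates and moves all other
      particles of the two levels to \<open>nu' 1\<close>.\<close>
    define mu where "mu i = (if i = 1 then lam 1 else if i \<in> {2..k} then nu' 1 else 0)" for i
    define kap where "kap i = (if i \<in> {1..k - 1} then nu' 1 else 0)" for i :: nat
    have "nu' 1 \<le> lam 1"
      using il k2 by (auto simp: interl_def)
    then have il': "interl k kap mu"
      using k2 by (auto simp: interl_def GT_def mu_def kap_def)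
    have vals: "mu 1 = lam 1" "kap 1 = nu' 1" "mu 2 = nu' 1"
      using k2 by (auto simp: mu_def kap_def)
    \<comment> \<open>Before its move the lower particle would lie to the left of
      \<open>mu 2\<close>, so the push term is absent from the equation.\<close>
    have "\<not> interl k (dec 1 kap) mu"
    proof
      assume "interl k (dec 1 kap) mu"
      then have "mu (1 + 1) \<le> dec 1 kap 1"
        using k2 unfolding interl_def by auto
      with vals show False by (simp add: dec_def numeral_2_eq_2)
    qed
    with eqn[OF k2 il'] have "W k mu (inc 1 mu) kap * (1 - q powi (lam 1 - nu' 1 + 1)) =
        a k * (1 - q powi (lam 1 - nu' 1 + 1))"
      unfolding vals by simp
    moreover have "q powi (lam 1 - nu' 1 + 1) < 1"
      using assms(1,2) \<open>nu' 1 \<le> lam 1\<close> by (intro powi_less_one) auto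
    ultimately have "W k mu (inc 1 mu) kap = a k" by simp
    moreover have "W k lam (inc 1 lam) nu' = W k mu (inc 1 mu) kap"
      using R1 k il il' vals unfolding rightmost_jumps_autonomous_def by metis
    ultimately show ?thesis by simp
  qed
  have V: "V k lam (inc 1 lam) lam' (inc 1 lam') = q powi (lam 1 - lam' 1)"
    if k: "k \<in> {2..N}" and il: "interl k lam' lam" for k lam lam'
  proof -
    have k1: "k \<in> {1..N}" "1 \<le> k" "1 \<le> k - 1" "1 \<in> {1..k - 1}" using k by auto
    have le: "lam 2 \<le> lam' 1" "lam' 1 \<le> lam 1"
      using il k1(4) unfolding interl_def by (metis one_add_one)+
    have GT: "lam \<in> GT k" "lam' \<in> GT (k - 1)"
      using il by (auto simp: interl_def)
    have inc_at: "inc (Suc 0) lam' (Suc 0) = lam' (Suc 0) + 1"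
      by (simp add: inc_def)
    show ?thesis
    proof (cases "lam' 1 = lam 1")
      case True
      let ?V = "\<lambda>nu. V k lam nu lam' (inc 1 lam')"
      have "inc 1 lam' \<in> succs (k - 1) lam'"
        using inc_1_GT[OF GT(2) k1(3)] k1 by (auto simp: succs_def)
      then have V0: "\<forall>nu\<in>GT k. nu \<notin> succs k lam \<or> \<not> interl k (inc 1 lam') nu \<longrightarrow> ?V nu = 0"
        and V1: "(\<Sum>nu\<in>succs k lam. ?V nu) = 1"
        using dynamics k1(1) il unfolding multivariate_dynamics_def by blast+
      have fin: "finite (succs k lam)"
        by (rule finite_subset[of _ "insert lam ((\<lambda>j. inc j lam) ` {1..k})"]) (auto simp: succs_def)
      have mem: "inc 1 lam \<in> succs k lam"
        using inc_1_GT[OF GT(1) k1(2)] k1 by (auto simp: succs_def)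
      have "(\<Sum>nu\<in>succs k lam - {inc 1 lam}. ?V nu) = 0"
      proof (rule sum.neutral, rule ballI)
        fix nu assume nu: "nu \<in> succs k lam - {inc 1 lam}"
        then have "nu 1 = lam 1"
          by (auto simp: succs_def inc_def)
        then have "\<not> interl k (inc 1 lam') nu"
          using True k1(4) by (auto simp: interl_def inc_def)
        with V0 nu show "?V nu = 0"
          by (auto simp: succs_def)
      qed
      with V1 show ?thesis
        using True by (simp add: sum.remove[OF fin mem])
    next
      case False
      have "interl k (inc 1 lam') lam"
        using il le False inc_1_GT[OF GT(2) k1(3)] unfolding interl_def
        by (auto simp: inc_def numeral_2_eq_2)
      from eqn[OF k this] have
        "a k * V k lam (inc 1 lam) lam' (inc 1 lam') * (1 - q powi (lam' 1 + 1 - lam 2)) +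
         a k * (1 - q powi (lam 1 - lam' 1)) = a k * (1 - q powi (lam 1 - lam 2 + 1))"
        using W[OF k1(1) \<open>interl k (inc 1 lam') lam\<close>] il by (simp add: inc_at)
      then have "a k * (V k lam (inc 1 lam) lam' (inc 1 lam') * (1 - q powi (lam' 1 + 1 - lam 2))) =
          a k * (q powi (lam 1 - lam' 1) - q powi (lam 1 - lam 2 + 1))"
        by (simp add: algebra_simps)
      \<comment> \<open>Splitting the exponent exposes the same factor
        \<open>1 - q powi (lam' 1 + 1 - lam 2)\<close> on both sides; it is nonzero since
        \<open>lam 2 \<le> lam' 1\<close>.\<close>
      moreover have "q powi (lam 1 - lam 2 + 1) = q powi (lam 1 - lam' 1) * q powi (lam' 1 + 1 - lam 2)"
        using assms(1) by (subst power_int_add[symmetric]) (auto simp: algebra_simps)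
      moreover have "a k > 0" using assms(4) k1 by auto
      ultimately have "V k lam (inc 1 lam) lam' (inc 1 lam') * (1 - q powi (lam' 1 + 1 - lam 2)) =
          q powi (lam 1 - lam' 1) - q powi (lam 1 - lam' 1) * q powi (lam' 1 + 1 - lam 2)"
        by (metis mult_left_cancel less_irrefl)
      then have "V k lam (inc 1 lam) lam' (inc 1 lam') * (1 - q powi (lam' 1 + 1 - lam 2)) =
          q powi (lam 1 - lam' 1) * (1 - q powi (lam' 1 + 1 - lam 2))"
        by (simp add: right_diff_distrib)
      moreover have "q powi (lam' 1 + 1 - lam 2) < 1"
        using assms(1,2) le by (intro powi_less_one) auto
      ultimately show ?thesis by simp
    qed
  qed
  have "(\<Prod>i=k+1..m. V i (X i) (inc 1 (X i)) (X (i - 1)) (inc 1 (X (i - 1)))) > 0"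
    if "X \<in> arrays N" "1 \<le> k" "k < m" "m \<le> N" for X k m
  proof (intro prod_pos ballI)
    fix i assume "i \<in> {k+1..m}"
    with that have "i \<in> {2..N}" "interl i (X (i - 1)) (X i)"
      by (auto simp: arrays_def)
    then show "V i (X i) (inc 1 (X i)) (X (i - 1)) (inc 1 (X (i - 1))) > 0"
      using V assms(1) by simp
  qed
  with W V show ?thesis by blast
qed

end
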